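(* Let $\mathrm{SM}(\hat q)=\{p(\cdot,\theta):\theta\in\Theta\}$ be a simple mixture family such that $$\sup_{t\ge0}\|\mathcal L_t^\ast p(\cdot,\theta)\|_2<\infty\quad\text{for all }\theta\in\Theta.$$ Then closing the evolution equation $\frac{d}{dt}E_{p_t}[q-q_{n+1}\underline1]=E_{p_t}[\mathcal L_t(q-q_{n+1}\underline1)]$ of the $d_D$ metric projection onto $\mathrm{SM}(\hat q)$ of the solution $p_t$ of the Fokker-Planck-Kolmogorov equation, by forcing a mixture density on the right hand side (assumed density approximation), is equivalent to the locally optimal $d_D$ approximation given by tangent projection of the vector field in direct $L^2$ metric. Precisely: a differentiable curve $t\mapsto\theta_t\in\Theta$ satisfies the tangent projected equation $$\frac{d}{dt}p(\cdot,\theta_t)=\Pi^\gamma_{\theta_t}\left[\mathcal L_t^\ast p(\cdot,\theta_t)\right]$$ if and only if the corresponding expectation parameters $m_t=m(\theta_t)=E_{\theta_t}[q-q_{n+1}\underline1]$ satisfy the assumed density equation $$\dot m_t=E_{m_t}\left[\mathcal L_t(q-q_{n+1}\underline1)\right].$$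
   Context: Consider the stochastic differential equation $dX_t=f(X_t,t)\,dt+\sigma(X_t,t)\,dW_t$ in $\mathbb R^N$, and let $a=\sigma\sigma'$ (prime denotes transpose). The Fokker-Planck-Kolmogorov (FPK) equation for the density $p_t$ of $X_t$ is $\partial_tp_t=\mathcal L_t^\ast p_t$; the FPK operator and its formal adjoint are $$\mathcal L_t^\ast p=-\sum_{i=1}^N\frac{\partial}{\partial x_i}[f_i(\cdot,t)p]+\frac12\sum_{i,j=1}^N\frac{\partial^2}{\partial x_i\partial x_j}[a_{ij}(\cdot,t)p],\qquad \mathcal L_t\varphi=\sum_{i=1}^N f_i(\cdot,t)\frac{\partial\varphi}{\partial x_i}+\frac12\sum_{i,j=1}^N a_{ij}(\cdot,t)\frac{\partial^2\varphi}{\partial x_i\partial x_j};$$ $\mathcal L$ is applied componentwise to vectors. Simple mixture family: $\hat q=[q_1,\dots,q_{n+1}]'$ are $n+1$ fixed square integrable probability densities on $\mathbb R^N$, $q=[q_1,\dots,q_n]'$, $\underline1$ is the vector with $n$ components equal to $1$, $\hat\theta(\theta)=[\theta_1,\dots,\theta_n,1-\theta_1-\dots-\theta_n]'$, and $p(\cdot,\theta)=\hat\theta(\theta)'\hat q$ for $\theta\in\Theta$, where $\Theta$ is an open convex subset of $\mathbb R^n$ contained in $\{\theta:\theta_i\in[0,1]\ \forall i,\ 0<\sum_{i=1}^n\theta_i<1\}$. $E_\theta[\varphi]=\int\varphi(x)p(x,\theta)\,dx$, $E_p[\varphi]=\int\varphi(x)p(x)\,dx$. The matrix $\gamma_{ij}=\langle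 q_i-q_{n+1},q_j-q_{n+1}\rangle$ ($L^2$ inner product) is assumed positive definite, with inverse entries $\gamma^{ij}$. The expectation parameters are $m(\theta)=E_\theta[q-q_{n+1}\underline1]=\gamma\theta+\beta$ with $\beta=E_{q_{n+1}}[q-q_{n+1}\underline1]$; $p(\cdot;m)$ denotes the member of the family with expectation parameters $m$, and $E_m$ expectation under it. The tangent projection in direct metric of $v\in L^2$ is $$\Pi^\gamma_\theta[v]=\sum_{i=1}^n\left[\sum_{j=1}^n\gamma^{ij}\left\langle v,\frac{\partial p(\cdot,\theta)}{\partial\theta_j}\right\rangle\right]\frac{\partial p(\cdot,\theta)}{\partial\theta_i},\qquad\frac{\partial p(\cdot,\theta)}{\partial\theta_i}=q_i-q_{n+1}.$$ The $d_D$ metric projection (with $d_D(p_1,p_2)=\|p_1-p_2\|_2$) of $p$ onto $\mathrm{SM}(\hat q)$ is the member with expectation parameters $\tilde m=E_p[q-q_{n+1}\underline1]$; for $p=p_t$ one has $\frac{d}{dt}\tilde m_t=E_{p_t}[\mathcal L_t(q-q_{n+1}\underline1)]$. The assumed density approximation replaces, in this equation, $\tilde m_t$ by $m_t$ on the left and $p_t$ by $p(\cdot;m_t)$ on the right. Standing convention: integration by parts is legitimate, i.e. $\int\varphi\,\mathcal L_t^\ast p(\cdot,\theta)\,dx=\int(\mathcal L_t\varphi)\,p(\cdot,\theta)\,dx$ for $\varphi=q_i-q_{n+1}$, $i=1,\dots,n$. *)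

theory Defs
  imports "HOL-Analysis.Analysis"
begin

section \<open>Square integrable functions on Euclidean space\<close>

text \<open>Elements of \<open>L\<^sup>2\<close> are represented by functions; equality in \<open>L\<^sup>2\<close> is equality almost everywhere.\<close>

definition square_integrable :: "('a::euclidean_space \<Rightarrow> real) \<Rightarrow> bool" where
  "square_integrable g \<longleftrightarrow> g \<in> borel_measurable lebesgue \<and> integrable lebesgue (\<lambda>x. (g x)\<^sup>2)"

definition L2_inner :: "('a::euclidean_space \<Rightarrow> real) \<Rightarrow> ('a \<Rightarrow> real) \<Rightarrow> real" where
  "L2_inner g h = (\<integral>x. g x * h x \<partial>lebesgue)"

definition L2_norm :: "('a::euclidean_space \<Rightarrow> real) \<Rightarrow> real" where
  "L2_norm g = sqrt (L2_inner g g)"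

text \<open>Derivative of an \<open>L\<^sup>2\<close>-valued curve in the \<open>L\<^sup>2\<close> norm, relative to \<open>J\<close> (one-sided at
  end points). Square integrability is demanded explicitly because \<open>L2_norm\<close> is meaningless on
  functions outside \<open>L\<^sup>2\<close>.\<close>

definition has_L2_derivative ::
    "(real \<Rightarrow> 'a::euclidean_space \<Rightarrow> real) \<Rightarrow> ('a \<Rightarrow> real) \<Rightarrow> real \<Rightarrow> real set \<Rightarrow> bool" where
  "has_L2_derivative F v t J \<longleftrightarrow>
     (\<forall>s\<in>J. square_integrable (F s)) \<and> square_integrable v \<and>
     ((\<lambda>s. L2_norm (\<lambda>x. (F s x - F t x) / (s - t) - v x)) \<longlongrightarrow> 0) (at t within J)"

section \<open>The Fokker-Planck-Kolmogorov operator and its formal adjoint\<close>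

definition partial_deriv :: "'n::finite \<Rightarrow> (real^'n \<Rightarrow> real) \<Rightarrow> real^'n \<Rightarrow> real" where
  "partial_deriv i g x = deriv (\<lambda>s. g (x + s *\<^sub>R axis i 1)) 0"

definition diffusion_matrix ::
    "(real^'N \<Rightarrow> real \<Rightarrow> real^'d^'N) \<Rightarrow> real^'N \<Rightarrow> real \<Rightarrow> real^'N^'N" where
  "diffusion_matrix \<sigma> x t = \<sigma> x t ** transpose (\<sigma> x t)"

definition FPK_op ::
    "(real^'N \<Rightarrow> real \<Rightarrow> real^'N) \<Rightarrow> (real^'N \<Rightarrow> real \<Rightarrow> real^'d^'N) \<Rightarrow> real
      \<Rightarrow> (real^'N \<Rightarrow> real) \<Rightarrow> real^'N \<Rightarrow> real" where
  "FPK_op f \<sigma> t p x =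
     - (\<Sum>i\<in>UNIV. partial_deriv i (\<lambda>y. f y t $ i * p y) x)
     + 1/2 * (\<Sum>i\<in>UNIV. \<Sum>j\<in>UNIV.
         partial_deriv i (partial_deriv j (\<lambda>y. diffusion_matrix \<sigma> y t $ i $ j * p y)) x)"

definition backward_op ::
    "(real^'N \<Rightarrow> real \<Rightarrow> real^'N) \<Rightarrow> (real^'N \<Rightarrow> real \<Rightarrow> real^'d^'N) \<Rightarrow> real
      \<Rightarrow> (real^'N \<Rightarrow> real) \<Rightarrow> real^'N \<Rightarrow> real" where
  "backward_op f \<sigma> t \<phi> x =
     (\<Sum>i\<in>UNIV. f x t $ i * partial_deriv i \<phi> x)
     + 1/2 * (\<Sum>i\<in>UNIV. \<Sum>j\<in>UNIV.
         diffusion_matrix \<sigma> x t $ i $ j * partial_deriv i (partial_deriv j \<phi>) x)"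

section \<open>Simple mixture families\<close>

definition prob_density :: "('a::euclidean_space \<Rightarrow> real) \<Rightarrow> bool" where
  "prob_density g \<longleftrightarrow> (AE x in lebesgue. 0 \<le> g x) \<and> has_bochner_integral lebesgue g 1"

definition expect :: "('a::euclidean_space \<Rightarrow> real) \<Rightarrow> ('a \<Rightarrow> real) \<Rightarrow> real" where
  "expect p \<phi> = (\<integral>x. \<phi> x * p x \<partial>lebesgue)"

text \<open>The \<open>n + 1\<close> densities are indexed by \<open>'n option\<close>: \<open>Some i\<close> are the first \<open>n\<close> indices and
  \<open>None\<close> is the index \<open>n + 1\<close>.\<close>

definition theta_hat :: "real^'n \<Rightarrow> real^('n::finite option)" where
  "theta_hat \<theta> = (\<chi> k. case k of Some i \<Rightarrow> \<theta> $ i | None \<Rightarrow> 1 - (\<Sum>i\<in>UNIV. \<theta> $ i))"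

definition mixture ::
    "('n::finite option \<Rightarrow> real^'N \<Rightarrow> real) \<Rightarrow> real^'n \<Rightarrow> real^'N \<Rightarrow> real" where
  "mixture q \<theta> x = (\<Sum>k\<in>UNIV. theta_hat \<theta> $ k * q k x)"

definition q_diff :: "('n::finite option \<Rightarrow> real^'N \<Rightarrow> real) \<Rightarrow> 'n \<Rightarrow> real^'N \<Rightarrow> real" where
  "q_diff q i x = q (Some i) x - q None x"

definition gamma :: "('n::finite option \<Rightarrow> real^'N \<Rightarrow> real) \<Rightarrow> real^'n^'n" where
  "gamma q = (\<chi> i j. L2_inner (q_diff q i) (q_diff q j))"

definition pos_def_matrix :: "real^'n^'n \<Rightarrow> bool" where
  "pos_def_matrix A \<longleftrightarrow> transpose A = A \<and> (\<forall>v. v \<noteq> 0 \<longrightarrow> 0 < v \<bullet> (A *v v))"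

definition simple_mixture_family ::
    "('n::finite option \<Rightarrow> real^'N \<Rightarrow> real) \<Rightarrow> (real^'n) set \<Rightarrow> bool" where
  "simple_mixture_family q \<Theta> \<longleftrightarrow>
     (\<forall>k. prob_density (q k) \<and> square_integrable (q k)) \<and>
     open \<Theta> \<and> convex \<Theta> \<and>
     \<Theta> \<subseteq> {\<theta>. (\<forall>i. \<theta> $ i \<in> {0..1}) \<and> 0 < (\<Sum>i\<in>UNIV. \<theta> $ i) \<and> (\<Sum>i\<in>UNIV. \<theta> $ i) < 1} \<and>
     pos_def_matrix (gamma q)"

definition mean_param :: "('n::finite option \<Rightarrow> real^'N \<Rightarrow> real) \<Rightarrow> real^'n \<Rightarrow> real^'n" where
  "mean_param q \<theta> = (\<chi> i. expect (mixture q \<theta>) (q_diff q i))"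

text \<open>\<open>p(\<cdot>;m)\<close>, the member of the family with expectation parameters \<open>m\<close>; it is unique because
  \<open>gamma q\<close> is positive definite.\<close>

definition mixture_of_mean ::
    "('n::finite option \<Rightarrow> real^'N \<Rightarrow> real) \<Rightarrow> (real^'n) set \<Rightarrow> real^'n \<Rightarrow> real^'N \<Rightarrow> real" where
  "mixture_of_mean q \<Theta> m = mixture q (THE \<theta>. \<theta> \<in> \<Theta> \<and> mean_param q \<theta> = m)"

section \<open>Tangent projection and moment equations\<close>

text \<open>\<open>\<partial>p(\<cdot>,\<theta>)/\<partial>\<theta>\<^sub>i\<close>, which equals \<open>q_diff q i\<close>.\<close>

definition tangent_vec ::
    "('n::finite option \<Rightarrow> real^'N \<Rightarrow> real) \<Rightarrow> real^'n \<Rightarrow> 'n \<Rightarrow> real^'N \<Rightarrow> real" where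
  "tangent_vec q \<theta> i x = partial_deriv i (\<lambda>\<eta>. mixture q \<eta> x) \<theta>"

definition tangent_proj ::
    "('n::finite option \<Rightarrow> real^'N \<Rightarrow> real) \<Rightarrow> real^'n \<Rightarrow> (real^'N \<Rightarrow> real) \<Rightarrow> real^'N \<Rightarrow> real" where
  "tangent_proj q \<theta> v x =
     (\<Sum>i\<in>UNIV. (\<Sum>j\<in>UNIV. matrix_inv (gamma q) $ i $ j * L2_inner v (tangent_vec q \<theta> j))
        * tangent_vec q \<theta> i x)"

text \<open>The vector \<open>E\<^sub>p[L\<^sub>t(q - q\<^sub>n\<^sub>+\<^sub>1 1)]\<close>. With \<open>p = p\<^sub>t\<close> the solution of the
  Fokker-Planck-Kolmogorov equation it is the velocity of the expectation parameters of the
  \<open>L\<^sup>2\<close> metric projection of \<open>p\<^sub>t\<close>; the assumed density closure inserts \<open>p = p(\<cdot>;m\<^sub>t)\<close> instead.\<close>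

definition moment_rhs ::
    "(real^'N \<Rightarrow> real \<Rightarrow> real^'N) \<Rightarrow> (real^'N \<Rightarrow> real \<Rightarrow> real^'d^'N)
      \<Rightarrow> ('n::finite option \<Rightarrow> real^'N \<Rightarrow> real) \<Rightarrow> real \<Rightarrow> (real^'N \<Rightarrow> real) \<Rightarrow> real^'n" where
  "moment_rhs f \<sigma> q t p = (\<chi> i. expect p (backward_op f \<sigma> t (q_diff q i)))"

end

theory Submission
  imports Defs
begin

text \<open>
  A simple mixture family is an affine piece of \<open>L\<^sup>2\<close>: with the difference functions
  \<open>d\<^sub>i = q\<^sub>i - q\<^sub>n\<^sub>+\<^sub>1\<close> one has \<open>p(\<cdot>,\<theta>) = q\<^sub>n\<^sub>+\<^sub>1 + \<Sum>\<^sub>i \<theta>\<^sub>i d\<^sub>i\<close>. The tangent space is therefore the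
  same at every point, namely the span of the \<open>d\<^sub>i\<close>, and its Gram matrix is the constant matrix
  \<open>\<gamma>\<close>. Both equations of the theorem turn out to be coordinate forms of one ordinary differential
  equation for the parameters,
  \<open>\<theta>' = \<gamma>\<^sup>-\<^sup>1 b(\<theta>, t)\<close> with \<open>b\<^sub>i = \<langle>L\<^sub>t\<^sup>* p(\<cdot>,\<theta>), d\<^sub>i\<rangle>\<close>.

  For the projected equation: the projection of \<open>L\<^sub>t\<^sup>* p\<close> has coordinates \<open>\<gamma>\<^sup>-\<^sup>1 b\<close> with respect to
  the \<open>d\<^sub>i\<close>, and the \<open>L\<^sup>2\<close> norm on the span, read in coordinates, is \<open>c \<mapsto> (c \<bullet> \<gamma> c)\<^sup>1\<^sup>/\<^sup>2\<close>. Positive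
  definiteness makes it equivalent to the Euclidean norm, so differentiating the density in \<open>L\<^sup>2\<close>
  is the same as differentiating \<open>\<theta>\<close> (\<open>has_L2_derivative_mixture_iff\<close>).

  For the assumed density equation: the expectation parameters are \<open>m = \<gamma> \<theta> + \<beta>\<close>
  (\<open>mean_param_eq_affine\<close>), an invertible affine change of coordinates. Hence \<open>p(\<cdot>;m(\<theta>))\<close> is
  \<open>p(\<cdot>,\<theta>)\<close> itself, the left-hand side is \<open>m' = \<gamma> \<theta>'\<close>, and moving the generator from
  \<open>d\<^sub>i\<close> to the density by integration by parts identifies the right-hand side with \<open>b\<close>
  (\<open>moment_rhs_eq_inner\<close>).
\<close>

section \<open>Square integrable functions\<close>

lemma square_integrable_mult_integrable:
  assumes "square_integrable g" "square_integrable h"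
  shows "integrable lebesgue (\<lambda>x. g x * h x)"
proof (rule Bochner_Integration.integrable_bound)
  show "integrable lebesgue (\<lambda>x. (g x)\<^sup>2 + (h x)\<^sup>2)"
    using assms by (simp add: square_integrable_def)
  show "(\<lambda>x. g x * h x) \<in> borel_measurable lebesgue"
    using assms by (auto simp: square_integrable_def)
  have "\<bar>a * b\<bar> \<le> a\<^sup>2 + b\<^sup>2" for a b :: real
  proof -
    have "0 \<le> (\<bar>a\<bar> - \<bar>b\<bar>)\<^sup>2" by simp
    then have "2 * (\<bar>a\<bar> * \<bar>b\<bar>) \<le> a\<^sup>2 + b\<^sup>2"
      by (simp add: power2_eq_square algebra_simps)
    moreover have "0 \<le> \<bar>a\<bar> * \<bar>b\<bar>" by simp
    ultimately show ?thesis by (simp only: abs_mult)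
  qed
  then show "AE x in lebesgue. norm (g x * h x) \<le> norm ((g x)\<^sup>2 + (h x)\<^sup>2)"
    by simp
qed

lemma square_integrable_add:
  assumes "square_integrable g" "square_integrable h"
  shows "square_integrable (\<lambda>x. g x + h x)"
proof -
  have "integrable lebesgue (\<lambda>x. (g x)\<^sup>2 + (h x)\<^sup>2 + 2 * (g x * h x))"
    using assms square_integrable_mult_integrable[OF assms]
    by (simp add: square_integrable_def)
  then have "integrable lebesgue (\<lambda>x. (g x + h x)\<^sup>2)"
    by (simp add: power2_sum mult.assoc)
  then show ?thesis using assms by (auto simp: square_integrable_def)
qed

lemma square_integrable_cmult:
  "square_integrable g \<Longrightarrow> square_integrable (\<lambda>x. c * g x)"
  by (auto simp: square_integrable_def power_mult_distrib)

lemma square_integrable_sum: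
  assumes "finite I" "\<And>i. i \<in> I \<Longrightarrow> square_integrable (g i)"
  shows "square_integrable (\<lambda>x. \<Sum>i\<in>I. g i x)"
  using assms
proof (induction I rule: finite_induct)
  case empty
  then show ?case by (simp add: square_integrable_def)
next
  case (insert a I)
  then show ?case by (simp add: square_integrable_add)
qed

section \<open>Positive definite matrices\<close>

lemma pos_def_matrix_inv:
  fixes A :: "real^'n^'n"
  assumes "pos_def_matrix A"
  shows "A ** matrix_inv A = mat 1" "matrix_inv A ** A = mat 1"
proof -
  have "x = 0" if "A *v x = 0" for x
    using assms that by (metis inner_zero_right less_irrefl pos_def_matrix_def)
  then obtain B where "B ** A = mat 1"
    using matrix_left_invertible_ker by blast
  then have "\<exists>B. A ** B = mat 1 \<and> B ** A = mat 1"
    using matrix_left_right_inverse by blast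
  then have "A ** matrix_inv A = mat 1 \<and> matrix_inv A ** A = mat 1"
    unfolding matrix_inv_def by (rule someI_ex)
  then show "A ** matrix_inv A = mat 1" "matrix_inv A ** A = mat 1" by auto
qed

text \<open>The quadratic form is continuous and positive on the compact unit sphere, so it is bounded
  below there by a positive number; homogeneity extends the bound to all vectors.\<close>

lemma pos_def_matrix_coercive:
  fixes A :: "real^'n^'n"
  assumes "pos_def_matrix A"
  obtains k where "0 < k" "\<And>v. k * (norm v)\<^sup>2 \<le> v \<bullet> (A *v v)"
proof -
  let ?Q = "\<lambda>v. v \<bullet> (A *v v)"
  have "axis undefined 1 \<in> sphere (0 :: real^'n) 1" by (simp add: norm_axis_1)
  then have "sphere (0 :: real^'n) 1 \<noteq> {}" by blast
  moreover have "continuous_on (sphere 0 1) ?Q"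
    by (intro continuous_intros linear_continuous_on_compose matrix_vector_mul_linear)
  ultimately obtain u where u: "u \<in> sphere 0 1" "\<And>v. v \<in> sphere 0 1 \<Longrightarrow> ?Q u \<le> ?Q v"
    using continuous_attains_inf[of "sphere 0 1" ?Q] by auto
  have "u \<noteq> 0" using u(1) by auto
  then have "0 < ?Q u" using assms by (auto simp: pos_def_matrix_def)
  moreover have "?Q u * (norm v)\<^sup>2 \<le> ?Q v" for v
  proof (cases "v = 0")
    case False
    define w where "w = v /\<^sub>R norm v"
    have "w \<in> sphere 0 1" and v: "v = norm v *\<^sub>R w" using False by (auto simp: w_def)
    then have "?Q u \<le> ?Q w" using u(2) by blast
    moreover have "?Q v = (norm v)\<^sup>2 * ?Q w"
      by (subst (1 2) v)
        (simp add: matrix_vector_mult_scaleR power2_eq_square mult.assoc)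
    ultimately show ?thesis
      by (metis mult.commute mult_left_mono zero_le_power2)
  qed simp
  ultimately show ?thesis using that by blast
qed

section \<open>Derivatives of curves\<close>

lemma has_vector_derivative_iff_quotient:
  fixes c :: "real \<Rightarrow> 'a::real_normed_vector"
  shows "(c has_vector_derivative w) (at t within J) \<longleftrightarrow>
    ((\<lambda>s. (c s - c t) /\<^sub>R (s - t) - w) \<longlongrightarrow> 0) (at t within J)"
proof -
  have *: "norm (c s - c t - (s - t) *\<^sub>R w) / norm (s - t) = norm ((c s - c t) /\<^sub>R (s - t) - w)"
    if "s \<noteq> t" for s
  proof -
    have "(c s - c t) /\<^sub>R (s - t) - w = (c s - c t - (s - t) *\<^sub>R w) /\<^sub>R (s - t)"
      using that by (simp add: scaleR_diff_right)
    then show ?thesis by (simp add: divide_inverse_commute)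
  qed
  have "((\<lambda>s. norm (c s - c t - (s - t) *\<^sub>R w) / norm (s - t)) \<longlongrightarrow> 0) (at t within J) \<longleftrightarrow>
    ((\<lambda>s. norm ((c s - c t) /\<^sub>R (s - t) - w)) \<longlongrightarrow> 0) (at t within J)"
    by (rule filterlim_cong) (auto simp: eventually_at_filter * simp del: real_norm_def)
  then show ?thesis
    by (simp add: has_vector_derivative_def has_derivative_iff_norm tendsto_norm_zero_iff
        bounded_linear_scaleR_left)
qed

lemma has_vector_derivative_invertible_iff:
  fixes A B :: "real^'n^'n"
  assumes "A ** B = mat 1" "B ** A = mat 1"
  shows "((\<lambda>s. A *v c s + a) has_vector_derivative w) F \<longleftrightarrow>
    (c has_vector_derivative (B *v w)) F"
proof
  assume "((\<lambda>s. A *v c s + a) has_vector_derivative w) F"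
  then have "((\<lambda>s. A *v c s + a - a) has_vector_derivative w - 0) F"
    by (intro has_vector_derivative_diff has_vector_derivative_const)
  then have "((\<lambda>s. B *v (A *v c s)) has_vector_derivative (B *v w)) F"
    using bounded_linear.has_vector_derivative[OF matrix_vector_mul_bounded_linear] by fastforce
  then show "(c has_vector_derivative (B *v w)) F"
    by (simp add: matrix_vector_mul_assoc assms)
next
  assume "(c has_vector_derivative (B *v w)) F"
  then have "((\<lambda>s. A *v c s + a) has_vector_derivative (A *v (B *v w) + 0)) F"
    by (intro has_vector_derivative_add has_vector_derivative_const
        bounded_linear.has_vector_derivative[OF matrix_vector_mul_bounded_linear])
  then show "((\<lambda>s. A *v c s + a) has_vector_derivative w) F"
    by (simp add: matrix_vector_mul_assoc assms)
qed

section \<open>The affine geometry of a simple mixture family\<close>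

definition tangent_comb ::
    "('n::finite option \<Rightarrow> real^'N \<Rightarrow> real) \<Rightarrow> real^'n \<Rightarrow> real^'N \<Rightarrow> real" where
  "tangent_comb q c x = (\<Sum>i\<in>UNIV. c $ i * q_diff q i x)"

lemma mixture_eq_affine: "mixture q \<theta> x = q None x + tangent_comb q \<theta> x"
proof -
  have "mixture q \<theta> x = (1 - (\<Sum>i\<in>UNIV. \<theta> $ i)) * q None x + (\<Sum>i\<in>UNIV. \<theta> $ i * q (Some i) x)"
    by (simp add: mixture_def theta_hat_def UNIV_option_conv sum.reindex)
  then show ?thesis
    by (simp add: tangent_comb_def q_diff_def algebra_simps sum_subtractf sum_distrib_left)
qed

lemma tangent_vec_eq: "tangent_vec q \<theta> i = q_diff q i"
proof
  fix x
  have "mixture q (\<theta> + s *\<^sub>R axis i 1) x = mixture q \<theta> x + s * q_diff q i x" for s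
    by (simp add: mixture_eq_affine tangent_comb_def algebra_simps sum.distrib
        flip: sum_distrib_left) (simp add: axis_def if_distrib cong: if_cong)
  then show "tangent_vec q \<theta> i x = q_diff q i x"
    unfolding tangent_vec_def partial_deriv_def
    by (auto intro!: DERIV_imp_deriv derivative_eq_intros)
qed

lemma tangent_proj_eq_comb:
  "tangent_proj q \<theta> v = tangent_comb q (matrix_inv (gamma q) *v (\<chi> j. L2_inner v (q_diff q j)))"
  by (rule ext) (simp add: tangent_proj_def tangent_comb_def tangent_vec_eq matrix_vector_mult_def)

lemma square_integrable_q_diff:
  assumes "\<And>k. square_integrable (q k)"
  shows "square_integrable (q_diff q i)"
  using square_integrable_add[OF assms square_integrable_cmult[OF assms], of "Some i" "-1" None]
  by (simp add: q_diff_def[abs_def])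

lemma square_integrable_tangent_comb:
  assumes "\<And>k. square_integrable (q k)"
  shows "square_integrable (tangent_comb q c)"
  unfolding tangent_comb_def[abs_def]
  by (intro square_integrable_sum square_integrable_cmult square_integrable_q_diff assms) simp

lemma square_integrable_mixture:
  assumes "\<And>k. square_integrable (q k)"
  shows "square_integrable (mixture q \<theta>)"
  unfolding mixture_eq_affine[abs_def]
  by (intro square_integrable_add square_integrable_tangent_comb assms)

lemma L2_inner_q_diff_tangent_comb:
  assumes "\<And>k. square_integrable (q k)"
  shows "L2_inner (q_diff q i) (tangent_comb q c) = (gamma q *v c) $ i"
proof -
  note integrable = square_integrable_mult_integrable[OF square_integrable_q_diff[of q, OF assms]
      square_integrable_q_diff[of q, OF assms]]
  have "L2_inner (q_diff q i) (tangent_comb q c) =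
      (\<integral>x. (\<Sum>j\<in>UNIV. c $ j * (q_diff q i x * q_diff q j x)) \<partial>lebesgue)"
    by (simp add: L2_inner_def tangent_comb_def sum_distrib_left mult.left_commute)
  also have "\<dots> = (\<Sum>j\<in>UNIV. c $ j * L2_inner (q_diff q i) (q_diff q j))"
    using integrable by (simp add: L2_inner_def)
  finally show ?thesis by (simp add: gamma_def matrix_vector_mult_def mult.commute)
qed

lemma L2_inner_tangent_comb:
  assumes "\<And>k. square_integrable (q k)"
  shows "L2_inner (tangent_comb q c) (tangent_comb q c) = c \<bullet> (gamma q *v c)"
proof -
  note integrable = square_integrable_mult_integrable[OF square_integrable_q_diff[of q, OF assms]
      square_integrable_tangent_comb[of q, OF assms]]
  have "L2_inner (tangent_comb q c) (tangent_comb q c) =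
      (\<integral>x. (\<Sum>i\<in>UNIV. c $ i * (q_diff q i x * tangent_comb q c x)) \<partial>lebesgue)"
    by (simp add: L2_inner_def tangent_comb_def[of q c] sum_distrib_right mult.assoc)
  also have "\<dots> = (\<Sum>i\<in>UNIV. c $ i * L2_inner (q_diff q i) (tangent_comb q c))"
    using integrable by (simp add: L2_inner_def)
  finally show ?thesis by (simp add: L2_inner_q_diff_tangent_comb[of q, OF assms] inner_vec_def)
qed

text \<open>On the span of the difference functions the \<open>L\<^sup>2\<close> norm and the Euclidean norm of the
  coordinates define the same convergence: coercivity of \<open>\<gamma>\<close> bounds the latter by the former, and
  the converse is continuity of the quadratic form.\<close>

lemma L2_norm_tangent_comb_tendsto_iff:
  assumes L2: "\<And>k. square_integrable (q k)" and pos: "pos_def_matrix (gamma q)"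
  shows "((\<lambda>s. L2_norm (tangent_comb q (c s))) \<longlongrightarrow> 0) F \<longleftrightarrow> (c \<longlongrightarrow> 0) F"
proof -
  let ?N = "\<lambda>v. sqrt (v \<bullet> (gamma q *v v))"
  have N: "L2_norm (tangent_comb q v) = ?N v" for v
    by (simp add: L2_norm_def L2_inner_tangent_comb[OF L2])
  obtain k where k: "0 < k" "\<And>v. k * (norm v)\<^sup>2 \<le> v \<bullet> (gamma q *v v)"
    using pos_def_matrix_coercive[OF pos] by blast
  have lower: "norm v \<le> ?N v / sqrt k" for v
  proof -
    have "sqrt k * norm v = sqrt (k * (norm v)\<^sup>2)" by (simp add: real_sqrt_mult)
    also have "\<dots> \<le> ?N v" using k(2) by simp
    finally show ?thesis using k(1) by (simp add: field_simps)
  qed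
  show ?thesis unfolding N
  proof
    assume "((\<lambda>s. ?N (c s)) \<longlongrightarrow> 0) F"
    then have "((\<lambda>s. ?N (c s) / sqrt k) \<longlongrightarrow> 0) F"
      by (rule tendsto_divide_zero)
    then show "(c \<longlongrightarrow> 0) F"
      by (rule Lim_null_comparison[rotated]) (simp add: lower)
  next
    assume c: "(c \<longlongrightarrow> 0) F"
    then have "((\<lambda>s. gamma q *v c s) \<longlongrightarrow> gamma q *v 0) F"
      by (rule bounded_linear.tendsto[OF matrix_vector_mul_bounded_linear])
    with c have "((\<lambda>s. ?N (c s)) \<longlongrightarrow> sqrt (0 \<bullet> (gamma q *v 0))) F"
      by (intro tendsto_real_sqrt tendsto_inner)
    then show "((\<lambda>s. ?N (c s)) \<longlongrightarrow> 0) F" by simp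
  qed
qed

text \<open>Since the family is affine, the difference quotient of the density minus a tangent vector is
  again a tangent vector, whose coordinates are the difference quotient of the parameters minus
  the coordinates of that vector.\<close>

lemma has_L2_derivative_mixture_iff:
  assumes L2: "\<And>k. square_integrable (q k)" and pos: "pos_def_matrix (gamma q)"
  shows "has_L2_derivative (\<lambda>s. mixture q (\<theta> s)) (tangent_comb q w) t J \<longleftrightarrow>
    (\<theta> has_vector_derivative w) (at t within J)"
proof -
  have quotient: "(\<lambda>x. (mixture q (\<theta> s) x - mixture q (\<theta> t) x) / (s - t) - tangent_comb q w x) =
      tangent_comb q ((\<theta> s - \<theta> t) /\<^sub>R (s - t) - w)" for s
    by (rule ext)
      (simp add: mixture_eq_affine tangent_comb_def divide_inverse sum_distrib_right
        flip: sum_subtractf, simp add: algebra_simps)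
  show ?thesis
    by (simp add: has_L2_derivative_def quotient L2_norm_tangent_comb_tendsto_iff[OF L2 pos]
        has_vector_derivative_iff_quotient square_integrable_mixture[of q, OF L2]
        square_integrable_tangent_comb[of q, OF L2])
qed

section \<open>Expectation parameters and the assumed density closure\<close>

lemma mean_param_eq_affine:
  assumes "\<And>k. square_integrable (q k)"
  shows "mean_param q \<theta> = gamma q *v \<theta> + (\<chi> i. L2_inner (q_diff q i) (q None))"
proof -
  note L2 = square_integrable_q_diff[of q, OF assms]
  have "expect (mixture q \<theta>) (q_diff q i) =
      L2_inner (q_diff q i) (q None) + L2_inner (q_diff q i) (tangent_comb q \<theta>)" for i
    using square_integrable_mult_integrable[OF L2 assms]
      square_integrable_mult_integrable[OF L2 square_integrable_tangent_comb[of q, OF assms]]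
    by (simp add: expect_def L2_inner_def mixture_eq_affine distrib_left)
  then show ?thesis
    by (simp add: mean_param_def vec_eq_iff L2_inner_q_diff_tangent_comb[of q, OF assms])
qed

lemma mixture_of_mean_param:
  assumes L2: "\<And>k. square_integrable (q k)" and pos: "pos_def_matrix (gamma q)"
    and "\<theta> \<in> \<Theta>"
  shows "mixture_of_mean q \<Theta> (mean_param q \<theta>) = mixture q \<theta>"
proof -
  have "\<eta> = \<theta>" if "mean_param q \<eta> = mean_param q \<theta>" for \<eta>
  proof -
    have "gamma q *v \<eta> = gamma q *v \<theta>" using that by (simp add: mean_param_eq_affine[OF L2])
    then have "matrix_inv (gamma q) *v (gamma q *v \<eta>) = matrix_inv (gamma q) *v (gamma q *v \<theta>)"
      by simp
    then show ?thesis by (simp add: matrix_vector_mul_assoc pos_def_matrix_inv[OF pos])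
  qed
  then have "(THE \<eta>. \<eta> \<in> \<Theta> \<and> mean_param q \<eta> = mean_param q \<theta>) = \<theta>"
    using \<open>\<theta> \<in> \<Theta>\<close> by blast
  then show ?thesis by (simp add: mixture_of_mean_def)
qed

lemma moment_rhs_eq_inner:
  assumes "\<And>i. has_bochner_integral lebesgue (\<lambda>x. backward_op f \<sigma> t (q_diff q i) x * p x)
      (\<integral>x. q_diff q i x * FPK_op f \<sigma> t p x \<partial>lebesgue)"
  shows "moment_rhs f \<sigma> q t p = (\<chi> i. L2_inner (FPK_op f \<sigma> t p) (q_diff q i))"
  using has_bochner_integral_integral_eq[OF assms]
  by (simp add: moment_rhs_def expect_def L2_inner_def mult.commute vec_eq_iff)

theorem theorem4p5:
  fixes f :: "real^'N \<Rightarrow> real \<Rightarrow> real^'N"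
    and \<sigma> :: "real^'N \<Rightarrow> real \<Rightarrow> real^'d^'N"
    and q :: "'n::finite option \<Rightarrow> real^'N \<Rightarrow> real"
    and \<Theta> :: "(real^'n) set"
    and J :: "real set"
    and \<theta> :: "real \<Rightarrow> real^'n"
  assumes family: "simple_mixture_family q \<Theta>"
    and FPK_L2: "\<And>\<eta> t. \<eta> \<in> \<Theta> \<Longrightarrow> 0 \<le> t \<Longrightarrow> square_integrable (FPK_op f \<sigma> t (mixture q \<eta>))"
    and FPK_bounded:
      "\<And>\<eta>. \<eta> \<in> \<Theta> \<Longrightarrow> bdd_above ((\<lambda>t. L2_norm (FPK_op f \<sigma> t (mixture q \<eta>))) ` {0..})"
    and integration_by_parts:
      "\<And>\<eta> t i. \<eta> \<in> \<Theta> \<Longrightarrow> 0 \<le> t \<Longrightarrow>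
         has_bochner_integral lebesgue
           (\<lambda>x. backward_op f \<sigma> t (q_diff q i) x * mixture q \<eta> x)
           (\<integral>x. q_diff q i x * FPK_op f \<sigma> t (mixture q \<eta>) x \<partial>lebesgue)"
    and time_interval: "is_interval J" "interior J \<noteq> {}" "J \<subseteq> {0..}"
    and curve: "\<theta> differentiable_on J" "\<theta> ` J \<subseteq> \<Theta>"
  shows
    "(\<forall>t\<in>J. has_L2_derivative (\<lambda>s. mixture q (\<theta> s))
              (tangent_proj q (\<theta> t) (FPK_op f \<sigma> t (mixture q (\<theta> t)))) t J)
     \<longleftrightarrow>
     (\<forall>t\<in>J. ((\<lambda>s. mean_param q (\<theta> s)) has_vector_derivative
              moment_rhs f \<sigma> q t (mixture_of_mean q \<Theta> (mean_param q (\<theta> t)))) (at t within J))"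
proof -
  have L2: "\<And>k. square_integrable (q k)" and pos: "pos_def_matrix (gamma q)"
    using family by (auto simp: simple_mixture_family_def)
  \<comment> \<open>At each time both equations say that \<open>\<theta>\<close> has derivative \<open>\<gamma>\<^sup>-\<^sup>1 b\<close>.\<close>
  show ?thesis
  proof (rule ball_cong[OF refl])
    fix t assume "t \<in> J"
    then have \<theta>: "\<theta> t \<in> \<Theta>" and t: "0 \<le> t" using curve(2) time_interval(3) by auto
    define b where "b = (\<chi> i. L2_inner (FPK_op f \<sigma> t (mixture q (\<theta> t))) (q_diff q i))"
    have "has_L2_derivative (\<lambda>s. mixture q (\<theta> s))
          (tangent_proj q (\<theta> t) (FPK_op f \<sigma> t (mixture q (\<theta> t)))) t J \<longleftrightarrow>
        (\<theta> has_vector_derivative (matrix_inv (gamma q) *v b)) (at t within J)"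
      by (simp add: tangent_proj_eq_comb has_L2_derivative_mixture_iff[OF L2 pos] b_def)
    also have "\<dots> \<longleftrightarrow> ((\<lambda>s. mean_param q (\<theta> s)) has_vector_derivative b) (at t within J)"
      unfolding mean_param_eq_affine[OF L2]
      by (rule has_vector_derivative_invertible_iff[OF pos_def_matrix_inv[OF pos], symmetric])
    also have "b = moment_rhs f \<sigma> q t (mixture_of_mean q \<Theta> (mean_param q (\<theta> t)))"
      unfolding mixture_of_mean_param[OF L2 pos \<theta>] b_def
      by (rule moment_rhs_eq_inner[OF integration_by_parts[OF \<theta> t], symmetric])
    finally show "has_L2_derivative (\<lambda>s. mixture q (\<theta> s))
          (tangent_proj q (\<theta> t) (FPK_op f \<sigma> t (mixture q (\<theta> t)))) t J \<longleftrightarrow>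
        ((\<lambda>s. mean_param q (\<theta> s)) has_vector_derivative
          moment_rhs f \<sigma> q t (mixture_of_mean q \<Theta> (mean_param q (\<theta> t)))) (at t within J)" .
  qed
qed

end
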